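(* $\mathsf{LTL}_{\mathsf{F},\land}[\{p,q,r\}]$ does not admit finite characterizations over $\mathcal{W}^{\leq\omega}$, nor over $\mathcal{W}^{=\omega}$.
   Context: Words: for a countable ordinal $\alpha$, an $\alpha$-word over $\mathsf{AP}=\{p,q,r\}$ is a function $w:\alpha\to\mathcal{P}(\mathsf{AP})$; $|w|=\alpha$; $w[\beta..]$ is the suffix $w'$ with $w'[\gamma]=w[\beta+\gamma]$. $\mathcal{W}^{\leq\omega}$: words of length $\leq\omega$; $\mathcal{W}^{=\omega}$: words of length exactly $\omega$. Semantics: $w\models s$ ($s\in\mathsf{AP}$) iff $s\in w[0]$; $\land$ as usual; $w\models\mathsf{F}\varphi$ iff there is $\alpha<|w|$ with $w[\alpha..]\models\varphi$. $\mathsf{LTL}_{\mathsf{F},\land}[\{p,q,r\}]$ is the set of formulas built from $p,q,r$ using only $\mathsf{F}$ and $\land$. $[\![\varphi]\!]$ denotes the set of all countable-ordinal-length words satisfying $\varphi$. A labeled example is $(w,\ell)$ with $\ell\in\{+,-\}$; $\varphi$ fits it if ($w\models\varphi$ and $\ell=+$) or ($w\not\models\varphi$ and $\ell=-$). A fragment $\mathcal{L}$ admits finite characterizations over a class $\mathcal{W}$ of words if for every $\varphi\in\mathcal{L}$ there is a finite set $E$ of labeled examples with words in $\mathcal{W}$ such that $\varphi$ fits $E$ and every $\psi\in\mathcal{L}$ fitting $E$ satisfies $[\![\psi]\!]\cap\mathcal{W}=[\![\varphi]\!]\cap\mathcal{W}$. *)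

theory Defs imports Main
begin

text \<open>
  A word of countable ordinal length is represented by a well-order on a set of natural numbers
  (its positions) together with a labelling of the positions. Every countable ordinal is the order
  type of such a well-order; the length of the word is this order type. The labels of numbers
  outside the field are irrelevant, and isomorphic representations denote the same word
  (see \<open>sat_iso\<close> below).
\<close>

type_synonym 'a word = "nat rel \<times> (nat \<Rightarrow> 'a set)"

abbreviation len :: "'a word \<Rightarrow> nat rel" where
  "len w \<equiv> fst w"

abbreviation pos :: "'a word \<Rightarrow> nat set" where
  "pos w \<equiv> Field (len w)"

abbreviation letter :: "'a word \<Rightarrow> nat \<Rightarrow> 'a set" where
  "letter w \<equiv> snd w"

definition is_word :: "'a word \<Rightarrow> bool" where
  "is_word w \<longleftrightarrow> Well_order (len w)"

definition first_pos :: "'a word \<Rightarrow> nat \<Rightarrow> bool" where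
  "first_pos w x \<longleftrightarrow> x \<in> pos w \<and> (\<forall>y\<in>pos w. (x, y) \<in> len w)"

text \<open>
  If \<open>x\<close> is the position with index \<open>\<beta>\<close>, then the \<open>\<gamma>\<close>-th
  position at or after \<open>x\<close> is the one with index \<open>\<beta> + \<gamma>\<close>; so the
  suffix starting at \<open>\<beta>\<close> is the restriction to the positions from \<open>x\<close> on.
\<close>

definition suffix :: "'a word \<Rightarrow> nat \<Rightarrow> 'a word" where
  "suffix w x = (Restr (len w) {y. (x, y) \<in> len w}, letter w)"

definition words_le_omega :: "'a word set" where
  "words_le_omega = {w. is_word w \<and> (len w, natLeq) \<in> ordLeq}"

definition words_eq_omega :: "'a word set" where
  "words_eq_omega = {w. is_word w \<and> (len w, natLeq) \<in> ordIso}"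

datatype 'a formula =
    Prop 'a
  | Conj "'a formula" "'a formula"
  | Ev "'a formula"

text \<open>The empty word has no first letter and satisfies no propositional letter.\<close>

primrec sat :: "'a word \<Rightarrow> 'a formula \<Rightarrow> bool" where
  "sat w (Prop s) \<longleftrightarrow> (\<exists>x. first_pos w x \<and> s \<in> letter w x)"
| "sat w (Conj \<phi> \<psi>) \<longleftrightarrow> sat w \<phi> \<and> sat w \<psi>"
| "sat w (Ev \<phi>) \<longleftrightarrow> (\<exists>x\<in>pos w. sat (suffix w x) \<phi>)"

definition models :: "'a formula \<Rightarrow> 'a word set" where
  "models \<phi> = {w. is_word w \<and> sat w \<phi>}"

datatype label = Positive | Negative

definition fits :: "'a formula \<Rightarrow> ('a word \<times> label) set \<Rightarrow> bool" where
  "fits \<phi> E \<longleftrightarrow>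
     (\<forall>(w, l)\<in>E. sat w \<phi> \<and> l = Positive \<or> \<not> sat w \<phi> \<and> l = Negative)"

definition admits_finite_characterizations :: "'a formula set \<Rightarrow> 'a word set \<Rightarrow> bool" where
  "admits_finite_characterizations L W \<longleftrightarrow>
     (\<forall>\<phi>\<in>L. \<exists>E. finite E \<and> fst ` E \<subseteq> W \<and> fits \<phi> E \<and>
        (\<forall>\<psi>\<in>L. fits \<psi> E \<longrightarrow> models \<psi> \<inter> W = models \<phi> \<inter> W))"

datatype ap = P | Q | R

definition LTL_F_and :: "ap formula set" where
  "LTL_F_and = UNIV"

lemma sat_iso:
  assumes "bij_betw f (pos v) (pos w)"
    and "\<And>x y. x \<in> pos v \<Longrightarrow> y \<in> pos v \<Longrightarrow> (x, y) \<in> len v \<longleftrightarrow> (f x, f y) \<in> len w"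
    and "\<And>x. x \<in> pos v \<Longrightarrow> letter v x = letter w (f x)"
    and "is_word v" and "is_word w"
  shows "sat v \<phi> \<longleftrightarrow> sat w \<phi>"
  using assms
proof (induction \<phi> arbitrary: v w)
  case (Prop s)
  have im: "pos w = f ` pos v"
    using Prop(1) by (simp add: bij_betw_def)
  have "first_pos v x \<longleftrightarrow> first_pos w (f x)" if "x \<in> pos v" for x
    using that Prop(2) im unfolding first_pos_def by auto
  then have "(\<exists>x\<in>pos v. first_pos v x \<and> s \<in> letter v x) \<longleftrightarrow>
      (\<exists>y\<in>pos w. first_pos w y \<and> s \<in> letter w y)"
    using Prop(3) unfolding im by simp
  moreover have "sat u (Prop s) \<longleftrightarrow> (\<exists>x\<in>pos u. first_pos u x \<and> s \<in> letter u x)" for u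
    by (auto simp: first_pos_def)
  ultimately show ?case by simp
next
  case (Conj \<phi> \<psi>)
  from Conj.IH(1)[OF Conj.prems] Conj.IH(2)[OF Conj.prems] show ?case by simp
next
  case (Ev \<phi>)
  have im: "pos w = f ` pos v" and inj: "inj_on f (pos v)"
    using Ev.prems(1) by (simp_all add: bij_betw_def)
  have wov: "Well_order (len v)" and wow: "Well_order (len w)"
    using Ev.prems(4,5) by (simp_all add: is_word_def)
  have pos_suffix: "pos (suffix u x) = {y \<in> pos u. (x, y) \<in> len u}"
    if "Well_order (len u)" for u :: "'a word" and x
    using that unfolding suffix_def
    by (auto simp: Field_def well_order_on_def linear_order_on_def partial_order_on_def
        preorder_on_def refl_on_def)
  have word_suffix: "is_word (suffix u x)" if "Well_order (len u)" for u :: "'a word" and x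
    using that unfolding suffix_def is_word_def by (simp add: Well_order_Restr)
  have "sat (suffix v x) \<phi> \<longleftrightarrow> sat (suffix w (f x)) \<phi>" if x: "x \<in> pos v" for x
  proof (rule Ev.IH)
    have "pos (suffix w (f x)) = f ` pos (suffix v x)"
      using x im Ev.prems(2) by (auto simp: pos_suffix[OF wov] pos_suffix[OF wow])
    moreover have "inj_on f (pos (suffix v x))"
      using inj by (rule inj_on_subset) (auto simp: pos_suffix[OF wov])
    ultimately show "bij_betw f (pos (suffix v x)) (pos (suffix w (f x)))"
      by (simp add: bij_betw_def)
  next
    fix y z assume "y \<in> pos (suffix v x)" "z \<in> pos (suffix v x)"
    then have "y \<in> pos v" "z \<in> pos v"
      by (simp_all add: pos_suffix[OF wov])
    then show "(y, z) \<in> len (suffix v x) \<longleftrightarrow> (f y, f z) \<in> len (suffix w (f x))"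
      using x Ev.prems(2) by (auto simp: suffix_def)
  next
    fix y assume "y \<in> pos (suffix v x)"
    then have "y \<in> pos v"
      by (simp add: pos_suffix[OF wov])
    then show "letter (suffix v x) y = letter (suffix w (f x)) (f y)"
      using Ev.prems(3) by (simp add: suffix_def)
  qed (use word_suffix wov wow in auto)
  then show ?case
    using im by auto
qed

end

theory Submission imports Defs
begin

text \<open>
  The formula \<open>F (P \<and> R \<and> F Q)\<close> has no finite characterization: it is the pointwise limit of the
  strictly weaker formulas \<open>F (P \<and> R) \<and> F (P \<and> F (R \<and> F (P \<and> F (R \<and> \<dots> F Q))))\<close>. Indeed, if a word
  carries \<open>P, R\<close> at position \<open>x\<close> but violates \<open>F (P \<and> R \<and> F Q)\<close>, then every \<open>Q\<close> lies before \<open>x\<close> and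
  the alternating chain has to visit a new position at each alternation, so that its length is
  bounded by the index of \<open>x\<close>, which is finite because the word has length at most \<open>\<omega>\<close>. A single
  position carrying both \<open>P\<close> and \<open>R\<close> with a later \<open>Q\<close>, on the other hand, admits chains of any length.
\<close>

lemma pos_refl: "is_word w \<Longrightarrow> x \<in> pos w \<Longrightarrow> (x, x) \<in> len w"
  by (auto simp: is_word_def order_on_defs refl_on_def)

lemma pos_trans: "is_word w \<Longrightarrow> (x, y) \<in> len w \<Longrightarrow> (y, z) \<in> len w \<Longrightarrow> (x, z) \<in> len w"
  by (auto simp: is_word_def order_on_defs elim: transD)

lemma pos_antisym: "is_word w \<Longrightarrow> (x, y) \<in> len w \<Longrightarrow> (y, x) \<in> len w \<Longrightarrow> x = y"
  by (auto simp: is_word_def order_on_defs elim: antisymD)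

lemma pos_total: "is_word w \<Longrightarrow> x \<in> pos w \<Longrightarrow> y \<in> pos w \<Longrightarrow> (x, y) \<in> len w \<or> (y, x) \<in> len w"
  using pos_refl[of w x] by (auto simp: is_word_def order_on_defs total_on_def)

lemma pos_suffix:
  assumes "is_word w"
  shows "pos (suffix w x) = {y. (x, y) \<in> len w}"
  using pos_refl[OF assms] by (fastforce simp: suffix_def Field_def)

text \<open>Nested suffixes collapse, so every subformula can be evaluated at a position of the one
  fixed word \<open>w\<close>.\<close>

lemma suffix_suffix:
  assumes "is_word w" "(x, y) \<in> len w"
  shows "suffix (suffix w x) y = suffix w y"
  using pos_trans[OF assms(1)] assms(2) by (auto simp: suffix_def)

lemma sat_suffix_Prop:
  assumes "is_word w" "x \<in> pos w"
  shows "sat (suffix w x) (Prop s) \<longleftrightarrow> s \<in> letter w x"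
proof -
  have "first_pos (suffix w x) y \<longleftrightarrow> y = x" for y
    unfolding first_pos_def pos_suffix[OF assms(1)] using pos_refl[OF assms] pos_antisym[OF assms(1)]
    by (auto simp: suffix_def)
  then show ?thesis
    by (simp add: suffix_def)
qed

lemma sat_suffix_Ev:
  assumes "is_word w"
  shows "sat (suffix w x) (Ev \<phi>) \<longleftrightarrow> (\<exists>y. (x, y) \<in> len w \<and> sat (suffix w y) \<phi>)"
  using suffix_suffix[OF assms] by (auto simp: pos_suffix[OF assms])

primrec alternation :: "nat \<Rightarrow> ap formula" where
  "alternation 0 = Prop Q"
| "alternation (Suc n) = Conj (Prop P) (Ev (Conj (Prop R) (Ev (alternation n))))"

definition limit_formula :: "ap formula" where
  "limit_formula = Ev (Conj (Conj (Prop P) (Prop R)) (Ev (Prop Q)))"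

text \<open>The first conjunct is what makes the sequence converge: the word alternating {P, Q} and
  {R} for omega steps satisfies every \<open>alternation n\<close>, yet has no position carrying
  both \<open>P\<close> and \<open>R\<close>.\<close>

definition approximant :: "nat \<Rightarrow> ap formula" where
  "approximant n = Conj (Ev (Conj (Prop P) (Prop R))) (Ev (alternation n))"

lemma sat_limit_formula:
  assumes "is_word w"
  shows "sat w limit_formula \<longleftrightarrow>
    (\<exists>x y. (x, y) \<in> len w \<and> P \<in> letter w x \<and> R \<in> letter w x \<and> Q \<in> letter w y)"
proof -
  have "sat (suffix w x) (Ev (Prop Q)) \<longleftrightarrow> (\<exists>y. (x, y) \<in> len w \<and> Q \<in> letter w y)" for x
    using sat_suffix_Ev[OF assms] sat_suffix_Prop[OF assms] by (metis FieldI2)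
  then show ?thesis
    unfolding limit_formula_def sat.simps(2) sat.simps(3)[of w]
    using sat_suffix_Prop[OF assms] by (metis FieldI1)
qed

lemma limit_formula_imp_approximant:
  assumes w: "is_word w" and "sat w limit_formula"
  shows "sat w (approximant n)"
proof -
  obtain x y where xy: "(x, y) \<in> len w" "P \<in> letter w x" "R \<in> letter w x" "Q \<in> letter w y"
    using assms by (auto simp: sat_limit_formula)
  then have x: "x \<in> pos w" and y: "y \<in> pos w"
    by (auto intro: FieldI1 FieldI2)
  have PR: "sat (suffix w x) (Prop P)" "sat (suffix w x) (Prop R)"
    using xy sat_suffix_Prop[OF w x] by auto
  have "sat (suffix w x) (Ev (alternation n))"
  proof (induction n)
    case 0
    then show ?case
      using xy sat_suffix_Prop[OF w y] by (auto simp: sat_suffix_Ev[OF w] simp del: sat.simps(1,3))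
  next
    case (Suc n)
    \<comment> \<open>\<open>Ev\<close> includes the present, so \<open>x\<close> itself witnesses
      every round; only the base case moves on to \<open>y\<close>.\<close>
    have "sat (suffix w x) (alternation (Suc n))"
      using Suc PR pos_refl[OF w x] sat_suffix_Ev[OF w] by (metis alternation.simps(2) sat.simps(2))
    then show ?case
      using pos_refl[OF w x] sat_suffix_Ev[OF w] by metis
  qed
  then obtain z where "(x, z) \<in> len w" "sat (suffix w z) (alternation n)"
    by (auto simp: sat_suffix_Ev[OF w] simp del: sat.simps)
  then show ?thesis
    using x PR unfolding approximant_def by (auto simp del: sat.simps(1) intro: FieldI2)
qed

text \<open>An embedding into \<open>natLeq\<close> serves as the index; its injectivity makes
  monotonicity strict. The bound on the length enters here: in a longer word, infinitely many
  positions may precede a given one, and chains before it need not be bounded.\<close>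

lemma word_le_omega_index:
  assumes "w \<in> words_le_omega"
  obtains f :: "nat \<Rightarrow> nat"
  where "\<And>x y. (x, y) \<in> len w \<Longrightarrow> f x \<le> f y"
    and "\<And>x y. (x, y) \<in> len w \<Longrightarrow> x \<noteq> y \<Longrightarrow> f x < f y"
proof -
  obtain f where wo: "Well_order (len w)" and f: "embed (len w) natLeq f"
    using assms by (auto simp: words_le_omega_def ordLeq_def)
  have "inj_on f (pos w)" "compat (len w) natLeq f"
    using embed_inj_on[OF wo f] embed_compat[OF f] by auto
  then have "f x \<le> f y" "x \<noteq> y \<Longrightarrow> f x < f y" if "(x, y) \<in> len w" for x y
    using that FieldI1[OF that] FieldI2[OF that]
    by (fastforce simp: compat_def natLeq_def inj_on_def)+
  then show ?thesis
    using that by blast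
qed

text \<open>Each round costs at least one index: if its \<open>P\<close> and its \<open>R\<close>
  shared a position, the final \<open>Q\<close> would make the limit formula true. The move from
  \<open>R\<close> to the rest of the chain is only counted as weakly increasing, which gives
  \<open>n\<close> rather than \<open>2 * n\<close>.\<close>

lemma alternation_length_bound:
  assumes w: "is_word w" and no: "\<not> sat w limit_formula"
    and le: "\<And>x y. (x, y) \<in> len w \<Longrightarrow> f x \<le> f y"
    and less: "\<And>x y. (x, y) \<in> len w \<Longrightarrow> x \<noteq> y \<Longrightarrow> f x < f y"
    and "x \<in> pos w" "sat (suffix w x) (alternation n)"
  shows "\<exists>z. (x, z) \<in> len w \<and> Q \<in> letter w z \<and> f x + n \<le> (f z :: nat)"
  using assms(5,6)
proof (induction n arbitrary: x)
  case 0
  then show ?case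
    using pos_refl[OF w] by (auto simp: sat_suffix_Prop[OF w] simp del: sat.simps)
next
  case (Suc n)
  then have "sat (suffix w x) (Ev (Conj (Prop R) (Ev (alternation n))))"
    and P: "P \<in> letter w x"
    using sat_suffix_Prop[OF w] by (metis alternation.simps(2) sat.simps(2))+
  then obtain y y' where y: "(x, y) \<in> len w" "R \<in> letter w y"
    and y': "(y, y') \<in> len w" "sat (suffix w y') (alternation n)"
    using sat_suffix_Prop[OF w] sat_suffix_Ev[OF w] by (metis FieldI2 sat.simps(2))
  obtain z where z: "(y', z) \<in> len w" "Q \<in> letter w z" "f y' + n \<le> f z"
    using Suc.IH y' by (metis FieldI2)
  have xz: "(x, z) \<in> len w"
    using y(1) y'(1) z(1) pos_trans[OF w] by blast
  then have "x \<noteq> y"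
    using no P y(2) z(2) by (auto simp: sat_limit_formula[OF w])
  then have "f x + Suc n \<le> f z"
    using less[OF y(1)] le[OF y'(1)] z(3) by linarith
  then show ?case
    using xz z(2) by blast
qed

lemma approximants_converge:
  assumes "w \<in> words_le_omega"
  shows "\<forall>\<^sub>F n in at_top. sat w (approximant n) \<longleftrightarrow> sat w limit_formula"
\<comment> \<open>Here both formulas are true, or both fail for want of a position carrying
  \<open>P\<close> and \<open>R\<close>, whatever \<open>n\<close> is.\<close>
proof (cases "sat w limit_formula \<or> \<not> sat w (Ev (Conj (Prop P) (Prop R)))")
  case True
  have "sat w (approximant n) \<longleftrightarrow> sat w limit_formula" for n
    using True assms limit_formula_imp_approximant[of w n]
    by (auto simp: words_le_omega_def approximant_def simp del: sat.simps(1,3))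
  then show ?thesis
    by simp
next
  case False
  have w: "is_word w"
    using assms by (simp add: words_le_omega_def)
  obtain x where x: "x \<in> pos w" "P \<in> letter w x" "R \<in> letter w x"
    using False sat_suffix_Prop[OF w] by (metis sat.simps(2,3))
  obtain f :: "nat \<Rightarrow> nat" where le: "\<And>x y. (x, y) \<in> len w \<Longrightarrow> f x \<le> f y"
    and less: "\<And>x y. (x, y) \<in> len w \<Longrightarrow> x \<noteq> y \<Longrightarrow> f x < f y"
    using word_le_omega_index[OF assms] by metis
  \<comment> \<open>The index of \<open>x\<close> is the threshold: the chain ends in a
    \<open>Q\<close> of index at least \<open>n\<close>, whereas every \<open>Q\<close> lies
    strictly before \<open>x\<close>.\<close>
  have "\<not> sat w (approximant n)" if "f x \<le> n" for n
  proof
    assume "sat w (approximant n)"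
    then obtain y where y: "y \<in> pos w" "sat (suffix w y) (alternation n)"
      by (auto simp: approximant_def simp del: sat.simps(1))
    obtain z where z: "(y, z) \<in> len w" "Q \<in> letter w z" "f y + n \<le> f z"
      using alternation_length_bound[of w f, OF w _ le less y] False by blast
    have "(x, z) \<notin> len w"
      using False x z(2) by (auto simp: sat_limit_formula[OF w])
    then have "(z, x) \<in> len w" "z \<noteq> x"
      using pos_total[OF w x(1) FieldI2[OF z(1)]] pos_refl[OF w x(1)] by auto
    then show False
      using less z(3) that by fastforce
  qed
  then show ?thesis
    using False by (auto simp: eventually_at_top_linorder)
qed

text \<open>The position carrying both \<open>P\<close> and \<open>R\<close> comes just after the
  only \<open>Q\<close>, too late for the limit formula. The padding by empty letters gives length
  exactly omega, so the same words serve both classes.\<close>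

definition separating_word :: "nat \<Rightarrow> ap word" where
  "separating_word n = (natLeq, \<lambda>i.
     if i < 2 * n then (if even i then {P} else {R})
     else if i = 2 * n then {Q}
     else if i = 2 * n + 1 then {P, R}
     else {})"

lemma is_word_separating_word: "is_word (separating_word n)"
  by (simp add: is_word_def separating_word_def natLeq_Well_order)

lemma separating_word_eq_omega: "separating_word n \<in> words_eq_omega"
  by (simp add: words_eq_omega_def is_word_separating_word)
    (simp add: separating_word_def ordIso_reflexive natLeq_Well_order)

lemma not_sat_limit_formula_separating_word: "\<not> sat (separating_word n) limit_formula"
  unfolding sat_limit_formula[OF is_word_separating_word]
  by (auto simp: separating_word_def natLeq_def split: if_splits)

lemma sat_approximant_separating_word: "sat (separating_word n) (approximant n)"
proof -
  let ?w = "separating_word n"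
  have pos: "pos ?w = UNIV" and len: "(i, j) \<in> len ?w \<longleftrightarrow> i \<le> j" for i j
    by (auto simp: separating_word_def natLeq_def Field_def)
  have prop_iff: "sat (suffix ?w i) (Prop s) \<longleftrightarrow> s \<in> letter ?w i" for i s
    by (simp add: sat_suffix_Prop[OF is_word_separating_word] pos del: sat.simps)
  have ev_iff: "sat (suffix ?w i) (Ev \<phi>) \<longleftrightarrow> (\<exists>j\<ge>i. sat (suffix ?w j) \<phi>)" for i \<phi>
    by (simp add: sat_suffix_Ev[OF is_word_separating_word] len del: sat.simps)
  \<comment> \<open>\<open>k\<close> counts the rounds left before the \<open>Q\<close>, so the
    induction runs backwards from position \<open>2 * n\<close>; \<open>k \<le> n\<close> keeps the
    subtraction exact.\<close>
  have alt: "sat (suffix ?w (2 * (n - k))) (alternation k)" if "k \<le> n" for k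
    using that
  proof (induction k)
    case 0
    then show ?case
      by (simp add: prop_iff del: sat.simps) (simp add: separating_word_def)
  next
    case (Suc k)
    let ?i = "2 * (n - Suc k)"
    have i: "Suc ?i \<le> 2 * (n - k)" "Suc ?i < 2 * n"
      using Suc.prems by auto
    have P: "P \<in> letter ?w ?i" and R: "R \<in> letter ?w (Suc ?i)"
      using i by (auto simp: separating_word_def)
    have "sat (suffix ?w (Suc ?i)) (Ev (alternation k))"
      unfolding ev_iff using i(1) Suc.IH[OF Suc_leD[OF Suc.prems]] by (intro exI conjI)
    then have "sat (suffix ?w (Suc ?i)) (Conj (Prop R) (Ev (alternation k)))"
      unfolding sat.simps(2) prop_iff using R by (intro conjI)
    then have "sat (suffix ?w ?i) (Ev (Conj (Prop R) (Ev (alternation k))))"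
      unfolding ev_iff[of ?i] by (intro exI conjI) (rule le_SucI[OF order_refl])
    then show ?case
      unfolding alternation.simps(2) sat.simps(2)[of "suffix ?w ?i"] prop_iff using P by (intro conjI)
  qed
  have "sat (suffix ?w (2 * n + 1)) (Conj (Prop P) (Prop R))"
    unfolding sat.simps(2) prop_iff by (simp add: separating_word_def)
  then have "sat ?w (Ev (Conj (Prop P) (Prop R)))"
    unfolding sat.simps(3)[of ?w] pos by (intro bexI UNIV_I)
  moreover have "sat ?w (Ev (alternation n))"
    unfolding sat.simps(3)[of ?w] pos using alt[OF order_refl] by (intro bexI UNIV_I)
  ultimately show ?thesis
    unfolding approximant_def sat.simps(2) by (intro conjI)
qed

text \<open>The upper inclusion yields convergence on all examples, the lower one puts the
  separating words into \<open>W\<close>; both classes of the theorem lie in this range.\<close>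

lemma no_finite_characterizations:
  assumes "words_eq_omega \<subseteq> W" "W \<subseteq> words_le_omega"
  shows "\<not> admits_finite_characterizations LTL_F_and W"
proof
  assume "admits_finite_characterizations LTL_F_and W"
  then obtain E where E: "finite E" "fst ` E \<subseteq> W" "fits limit_formula E"
    and unique: "\<And>\<psi>. fits \<psi> E \<Longrightarrow> models \<psi> \<inter> W = models limit_formula \<inter> W"
    unfolding admits_finite_characterizations_def LTL_F_and_def by (metis UNIV_I)
  have "\<forall>w\<in>fst ` E. \<forall>\<^sub>F n in at_top. sat w (approximant n) \<longleftrightarrow> sat w limit_formula"
    using approximants_converge E(2) assms(2) by blast
  \<comment> \<open>The thresholds depend on the word; finiteness of \<open>E\<close> gives a common
    one.\<close>
  with E(1) have "\<forall>\<^sub>F n in at_top. \<forall>w\<in>fst ` E. sat w (approximant n) \<longleftrightarrow> sat w limit_formula"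
    by (intro eventually_ball_finite) auto
  then obtain n where "\<forall>w\<in>fst ` E. sat w (approximant n) \<longleftrightarrow> sat w limit_formula"
    by (auto simp: eventually_at_top_linorder)
  then have "fits (approximant n) E"
    using E(3) by (fastforce simp: fits_def)
  moreover have "separating_word n \<in> W" "separating_word n \<in> models (approximant n)"
    "separating_word n \<notin> models limit_formula"
    using assms(1) separating_word_eq_omega is_word_separating_word
      sat_approximant_separating_word not_sat_limit_formula_separating_word
    by (auto simp: models_def)
  ultimately show False
    using unique by blast
qed

theorem theorem15:
  shows "\<not> admits_finite_characterizations LTL_F_and words_le_omega
    \<and> \<not> admits_finite_characterizations LTL_F_and words_eq_omega"
proof -
  have "words_eq_omega \<subseteq> words_le_omega"
    by (auto simp: words_eq_omega_def words_le_omega_def ordIso_imp_ordLeq)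
  then show ?thesis
    using no_finite_characterizations by blast
qed

end
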